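(* Let $(A,\mu,\alpha,\beta)$ be a left BiHom-alternative algebra over a field $\mathbb{K}$ of characteristic $0$, and let $d_t(x,y)=\sum_{i\ge0}d_i(x,y)t^i$ and $d'_t(x,y)=\sum_{i\ge0}d'_i(x,y)t^i$ be equivalent one-parameter formal deformations of $(A,\mu,\alpha,\beta)$. Then $d_1$ and $d'_1$ belong to the same cohomology class in $H^2_{\alpha,\beta}(A;A)$.
   Context: Write $xy=\mu(x,y)$. A left BiHom-alternative algebra $(A,\mu,\alpha,\beta)$ is a $\mathbb{K}$-vector space $A$ with a bilinear map $\mu:A\times A\to A$ and linear maps $\alpha,\beta:A\to A$ such that $\alpha\beta=\beta\alpha$, $\alpha(xy)=\alpha(x)\alpha(y)$, $\beta(xy)=\beta(x)\beta(y)$, and for all $x,y,z\in A$ $$as_{\alpha,\beta}(\beta(x),\alpha(y),z)+as_{\alpha,\beta}(\beta(y),\alpha(x),z)=0,$$ where $as_{\alpha,\beta}(x,y,z)=(xy)\beta(z)-\alpha(x)(yz)$. A one-parameter formal deformation of $(A,\mu,\alpha,\beta)$ is a formal power series $d_t=\sum_{i\ge0}d_it^i$, where each $d_i:A\times A\to A$ is $\mathbb{K}$-bilinear (extended $\mathbb{K}[[t]]$-bilinearly to $A[[t]]$; $\alpha,\beta$ are extended $\mathbb{K}[[t]]$-linearly) and $d_0=\mu$, such that $d_t(\alpha(x),\alpha(y))=\alpha(d_t(x,y))$, $d_t(\beta(x),\beta(y))=\beta(d_t(x,y))$ and $$d_t(d_t(\beta(x),\alpha(y)),\beta(z))-d_t(\alpha\beta(x),d_t(\alpha(y),z))+d_t(d_t(\beta(y),\alpha(x)),\beta(z))-d_t(\alpha\beta(y),d_t(\alpha(x),z))=0.$$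 Two deformations $d_t,d'_t$ are equivalent if there is a formal isomorphism of $\mathbb{K}[[t]]$-modules $\phi_t=\sum_{i\ge0}\phi_it^i:A[[t]]\to A[[t]]$, with each $\phi_i:A\to A$ $\mathbb{K}$-linear (extended $\mathbb{K}[[t]]$-linearly) and $\phi_0=\mathrm{Id}_A$, such that $\phi_t\circ\alpha=\alpha\circ\phi_t$, $\phi_t\circ\beta=\beta\circ\phi_t$ and $\phi_t(d_t(x,y))=d'_t(\phi_t(x),\phi_t(y))$. $C^n_{\alpha,\beta}(A;A)$ is the space of $n$-linear maps $f:A^n\to A$ with $\alpha f(x_1,\dots,x_n)=f(\alpha(x_1),\dots,\alpha(x_n))$ and $\beta f(x_1,\dots,x_n)=f(\beta(x_1),\dots,\beta(x_n))$. For $f\in C^1_{\alpha,\beta}(A;A)$, $\delta^1f(x,y)=xf(y)+f(x)y-f(xy)$. For $f\in C^2_{\alpha,\beta}(A;A)$, $$\delta^2f(x,y,z)=f(\beta(x),\alpha(y))\beta(z)-\alpha\beta(x)f(\alpha(y),z)+f(\beta(y),\alpha(x))\beta(z)-\alpha\beta(y)f(\alpha(x),z)$$ $$\qquad+f(\beta(x)\alpha(y),\beta(z))-f(\alpha\beta(x),\alpha(y)z)+f(\beta(y)\alpha(x),\beta(z))-f(\alpha\beta(y),\alpha(x)z).$$ One has $\delta^2\circ\delta^1=0$; $Z^2_{\alpha,\beta}(A;A)=\ker\delta^2$, $B^2_{\alpha,\beta}(A;A)=\delta^1(C^1_{\alpha,\beta}(A;A))$, $H^2_{\alpha,\beta}(A;A)=Z^2_{\alpha,\beta}(A;A)/B^2_{\alpha,\beta}(A;A)$.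 For any deformation, $d_1\in Z^2_{\alpha,\beta}(A;A)$. *)

theory Defs
  imports "HOL-Computational_Algebra.Formal_Power_Series"
begin

definition bilinear_map :: "('k::field \<Rightarrow> 'a::ab_group_add \<Rightarrow> 'a) \<Rightarrow> ('a \<Rightarrow> 'a \<Rightarrow> 'a) \<Rightarrow> bool" where
  "bilinear_map scale f \<longleftrightarrow>
     (\<forall>x. Vector_Spaces.linear scale scale (\<lambda>y. f x y)) \<and>
     (\<forall>y. Vector_Spaces.linear scale scale (\<lambda>x. f x y))"

definition bihom_as :: "('a \<Rightarrow> 'a \<Rightarrow> 'a::ab_group_add) \<Rightarrow> ('a \<Rightarrow> 'a) \<Rightarrow> ('a \<Rightarrow> 'a) \<Rightarrow> 'a \<Rightarrow> 'a \<Rightarrow> 'a \<Rightarrow> 'a" where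
  "bihom_as mu alpha beta x y z = mu (mu x y) (beta z) - mu (alpha x) (mu y z)"

locale left_bihom_alternative_algebra = vector_space scale
  for scale :: "'k::field \<Rightarrow> 'a::ab_group_add \<Rightarrow> 'a" +
  fixes mu :: "'a \<Rightarrow> 'a \<Rightarrow> 'a" and alpha beta :: "'a \<Rightarrow> 'a"
  assumes bilinear_mu: "bilinear_map scale mu"
    and linear_alpha: "Vector_Spaces.linear scale scale alpha"
    and linear_beta: "Vector_Spaces.linear scale scale beta"
    and alpha_beta_commute: "alpha \<circ> beta = beta \<circ> alpha"
    and alpha_mult: "alpha (mu x y) = mu (alpha x) (alpha y)"
    and beta_mult: "beta (mu x y) = mu (beta x) (beta y)"
    and left_alternative:
      "bihom_as mu alpha beta (beta x) (alpha y) z + bihom_as mu alpha beta (beta y) (alpha x) z = 0"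

text \<open>\<open>A[[t]]\<close> is the type \<open>'a fps\<close>, an element of \<open>A\<close> being identified with the constant
  series \<open>fps_const\<close>. A formal series of (bi)linear maps is the sequence of its coefficients.
  The next function is the action of \<open>K[[t]]\<close> on \<open>A[[t]]\<close>.\<close>

definition fps_scale :: "('k::field \<Rightarrow> 'a::ab_group_add \<Rightarrow> 'a) \<Rightarrow> 'k fps \<Rightarrow> 'a fps \<Rightarrow> 'a fps" where
  "fps_scale scale c X = Abs_fps (\<lambda>n. \<Sum>i=0..n. scale (fps_nth c i) (fps_nth X (n - i)))"

text \<open>\<open>K[[t]]\<close>-(bi)linear extensions to \<open>A[[t]]\<close>: of a single linear map, of a series of
  linear maps, and of a series of bilinear maps.\<close>

definition ext_map :: "('a \<Rightarrow> 'a) \<Rightarrow> 'a fps \<Rightarrow> 'a fps" where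
  "ext_map f X = Abs_fps (\<lambda>n. f (fps_nth X n))"

definition ext_lin :: "(nat \<Rightarrow> 'a::ab_group_add \<Rightarrow> 'a) \<Rightarrow> 'a fps \<Rightarrow> 'a fps" where
  "ext_lin phi X = Abs_fps (\<lambda>n. \<Sum>i=0..n. phi i (fps_nth X (n - i)))"

definition ext_bilin :: "(nat \<Rightarrow> 'a::ab_group_add \<Rightarrow> 'a \<Rightarrow> 'a) \<Rightarrow> 'a fps \<Rightarrow> 'a fps \<Rightarrow> 'a fps" where
  "ext_bilin d X Y =
     Abs_fps (\<lambda>n. \<Sum>i=0..n. \<Sum>j=0..n - i. d i (fps_nth X j) (fps_nth Y (n - i - j)))"

definition formal_deformation ::
  "('k::field \<Rightarrow> 'a::ab_group_add \<Rightarrow> 'a) \<Rightarrow> ('a \<Rightarrow> 'a \<Rightarrow> 'a) \<Rightarrow> ('a \<Rightarrow> 'a) \<Rightarrow> ('a \<Rightarrow> 'a)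
    \<Rightarrow> (nat \<Rightarrow> 'a \<Rightarrow> 'a \<Rightarrow> 'a) \<Rightarrow> bool" where
  "formal_deformation scale mu alpha beta d \<longleftrightarrow>
     (\<forall>i. bilinear_map scale (d i)) \<and> d 0 = mu \<and>
     (let D = ext_bilin d; C = fps_const in
       (\<forall>x y. D (C (alpha x)) (C (alpha y)) = ext_map alpha (D (C x) (C y))) \<and>
       (\<forall>x y. D (C (beta x)) (C (beta y)) = ext_map beta (D (C x) (C y))) \<and>
       (\<forall>x y z.
          D (D (C (beta x)) (C (alpha y))) (C (beta z))
        - D (C (alpha (beta x))) (D (C (alpha y)) (C z))
        + D (D (C (beta y)) (C (alpha x))) (C (beta z))
        - D (C (alpha (beta y))) (D (C (alpha x)) (C z)) = 0))"

definition equivalent_deformations ::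
  "('k::field \<Rightarrow> 'a::ab_group_add \<Rightarrow> 'a) \<Rightarrow> ('a \<Rightarrow> 'a) \<Rightarrow> ('a \<Rightarrow> 'a)
    \<Rightarrow> (nat \<Rightarrow> 'a \<Rightarrow> 'a \<Rightarrow> 'a) \<Rightarrow> (nat \<Rightarrow> 'a \<Rightarrow> 'a \<Rightarrow> 'a) \<Rightarrow> bool" where
  "equivalent_deformations scale alpha beta d d' \<longleftrightarrow>
     (\<exists>phi :: nat \<Rightarrow> 'a \<Rightarrow> 'a.
       (\<forall>i. Vector_Spaces.linear scale scale (phi i)) \<and> phi 0 = id \<and>
       module_hom (fps_scale scale) (fps_scale scale) (ext_lin phi) \<and> bij (ext_lin phi) \<and>
       ext_lin phi \<circ> ext_map alpha = ext_map alpha \<circ> ext_lin phi \<and>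
       ext_lin phi \<circ> ext_map beta = ext_map beta \<circ> ext_lin phi \<and>
       (\<forall>x y. ext_lin phi (ext_bilin d (fps_const x) (fps_const y)) =
              ext_bilin d' (ext_lin phi (fps_const x)) (ext_lin phi (fps_const y))))"

definition C1 :: "('k::field \<Rightarrow> 'a::ab_group_add \<Rightarrow> 'a) \<Rightarrow> ('a \<Rightarrow> 'a) \<Rightarrow> ('a \<Rightarrow> 'a) \<Rightarrow> ('a \<Rightarrow> 'a) set" where
  "C1 scale alpha beta = {f. Vector_Spaces.linear scale scale f \<and>
     (\<forall>x. alpha (f x) = f (alpha x)) \<and> (\<forall>x. beta (f x) = f (beta x))}"

definition C2 :: "('k::field \<Rightarrow> 'a::ab_group_add \<Rightarrow> 'a) \<Rightarrow> ('a \<Rightarrow> 'a) \<Rightarrow> ('a \<Rightarrow> 'a) \<Rightarrow> ('a \<Rightarrow> 'a \<Rightarrow> 'a) set" where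
  "C2 scale alpha beta = {f. bilinear_map scale f \<and>
     (\<forall>x y. alpha (f x y) = f (alpha x) (alpha y)) \<and>
     (\<forall>x y. beta (f x y) = f (beta x) (beta y))}"

definition delta1 :: "('a \<Rightarrow> 'a \<Rightarrow> 'a::ab_group_add) \<Rightarrow> ('a \<Rightarrow> 'a) \<Rightarrow> 'a \<Rightarrow> 'a \<Rightarrow> 'a" where
  "delta1 mu f x y = mu x (f y) + mu (f x) y - f (mu x y)"

definition delta2 ::
  "('a \<Rightarrow> 'a \<Rightarrow> 'a::ab_group_add) \<Rightarrow> ('a \<Rightarrow> 'a) \<Rightarrow> ('a \<Rightarrow> 'a) \<Rightarrow> ('a \<Rightarrow> 'a \<Rightarrow> 'a) \<Rightarrow> 'a \<Rightarrow> 'a \<Rightarrow> 'a \<Rightarrow> 'a" where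
  "delta2 mu alpha beta f x y z =
      mu (f (beta x) (alpha y)) (beta z) - mu (alpha (beta x)) (f (alpha y) z)
    + mu (f (beta y) (alpha x)) (beta z) - mu (alpha (beta y)) (f (alpha x) z)
    + f (mu (beta x) (alpha y)) (beta z) - f (alpha (beta x)) (mu (alpha y) z)
    + f (mu (beta y) (alpha x)) (beta z) - f (alpha (beta y)) (mu (alpha x) z)"

definition Z2 ::
  "('k::field \<Rightarrow> 'a::ab_group_add \<Rightarrow> 'a) \<Rightarrow> ('a \<Rightarrow> 'a \<Rightarrow> 'a) \<Rightarrow> ('a \<Rightarrow> 'a) \<Rightarrow> ('a \<Rightarrow> 'a) \<Rightarrow> ('a \<Rightarrow> 'a \<Rightarrow> 'a) set" where
  "Z2 scale mu alpha beta = {f \<in> C2 scale alpha beta. \<forall>x y z. delta2 mu alpha beta f x y z = 0}"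

definition B2 ::
  "('k::field \<Rightarrow> 'a::ab_group_add \<Rightarrow> 'a) \<Rightarrow> ('a \<Rightarrow> 'a \<Rightarrow> 'a) \<Rightarrow> ('a \<Rightarrow> 'a) \<Rightarrow> ('a \<Rightarrow> 'a) \<Rightarrow> ('a \<Rightarrow> 'a \<Rightarrow> 'a) set" where
  "B2 scale mu alpha beta = delta1 mu ` C1 scale alpha beta"

text \<open>The elements of \<open>H2\<close>, the cohomology classes, are the cosets of \<open>B2\<close> in \<open>Z2\<close>.\<close>

definition H2 ::
  "('k::field \<Rightarrow> 'a::ab_group_add \<Rightarrow> 'a) \<Rightarrow> ('a \<Rightarrow> 'a \<Rightarrow> 'a) \<Rightarrow> ('a \<Rightarrow> 'a) \<Rightarrow> ('a \<Rightarrow> 'a)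
    \<Rightarrow> ('a \<Rightarrow> 'a \<Rightarrow> 'a) set set" where
  "H2 scale mu alpha beta =
     Z2 scale mu alpha beta //
       {(f, g). f \<in> Z2 scale mu alpha beta \<and> g \<in> Z2 scale mu alpha beta \<and>
                (\<lambda>x y. f x y - g x y) \<in> B2 scale mu alpha beta}"

text \<open>Consistency: \<open>A[[t]]\<close> is a \<open>K[[t]]\<close>-module, and the linearity required of \<open>ext_lin phi\<close>
  in the definition of equivalence holds for every series of linear maps.\<close>

lemma module_fps_scale:
  assumes "vector_space (scale :: 'k::field \<Rightarrow> 'a::ab_group_add \<Rightarrow> 'a)"
  shows "module (fps_scale scale)"
proof -
  interpret vector_space scale by fact
  show ?thesis
  proof
    fix a b :: "'k fps" and x y :: "'a fps"
    show "fps_scale scale a (x + y) = fps_scale scale a x + fps_scale scale a y"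
      by (simp add: fps_eq_iff fps_scale_def scale_right_distrib sum.distrib)
    show "fps_scale scale (a + b) x = fps_scale scale a x + fps_scale scale b x"
      by (simp add: fps_eq_iff fps_scale_def scale_left_distrib sum.distrib)
    show "fps_scale scale 1 x = x"
    proof (rule fps_ext)
      fix n
      have "(\<Sum>i=0..n. scale (fps_nth 1 i) (fps_nth x (n - i))) = (\<Sum>i=0..n. if i = 0 then fps_nth x n else 0)"
        by (rule sum.cong) auto
      then show "fps_nth (fps_scale scale 1 x) n = fps_nth x n"
        by (simp add: fps_scale_def)
    qed
    show "fps_scale scale a (fps_scale scale b x) = fps_scale scale (a * b) x"
    proof (rule fps_ext)
      fix n
      let ?f = "\<lambda>i j k. scale (fps_nth a i * fps_nth b j) (fps_nth x k)"
      have "(\<Sum>j=0..n. \<Sum>i=0..j. ?f i (j - i) (n - j)) =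
            (\<Sum>j=0..n. \<Sum>i=0..n - j. ?f j i (n - j - i))"
        by (rule fps_mult_assoc_lemma)
      then show "fps_nth (fps_scale scale a (fps_scale scale b x)) n = fps_nth (fps_scale scale (a * b) x) n"
        by (simp add: fps_scale_def fps_mult_nth scale_sum_right scale_sum_left)
    qed
  qed
qed

lemma module_hom_ext_lin:
  assumes "vector_space (scale :: 'k::field \<Rightarrow> 'a::ab_group_add \<Rightarrow> 'a)"
    and "\<And>i. Vector_Spaces.linear scale scale (phi i)"
  shows "module_hom (fps_scale scale) (fps_scale scale) (ext_lin phi)"
proof -
  interpret V: vector_space scale by fact
  interpret p: Vector_Spaces.linear scale scale "phi i" for i by fact
  interpret M: module "fps_scale scale" by (rule module_fps_scale) fact
  show ?thesis
  proof
    fix c :: "'k fps" and x y :: "'a fps"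
    show "ext_lin phi (x + y) = ext_lin phi x + ext_lin phi y"
      by (simp add: fps_eq_iff ext_lin_def p.add sum.distrib)
    show "ext_lin phi (fps_scale scale c x) = fps_scale scale c (ext_lin phi x)"
    proof (rule fps_ext)
      fix n
      let ?f = "\<lambda>i j k. scale (fps_nth c j) (phi i (fps_nth x k))"
      have "(\<Sum>j=0..n. \<Sum>i=0..n - j. ?f j i (n - j - i)) =
            (\<Sum>j=0..n. \<Sum>i=0..j. ?f i (j - i) (n - j))"
        by (rule fps_mult_assoc_lemma[symmetric])
      also have "\<dots> = (\<Sum>j=0..n. \<Sum>i=0..j. ?f (j - i) i (n - j))"
        proof (rule sum.cong[OF refl])
        fix j
        show "(\<Sum>i=0..j. ?f i (j - i) (n - j)) = (\<Sum>i=0..j. ?f (j - i) i (n - j))"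
          by (rule sum.reindex_bij_witness[where i = "\<lambda>i. j - i" and j = "\<lambda>i. j - i"]) auto
      qed
      also have "\<dots> = (\<Sum>j=0..n. \<Sum>i=0..n - j. ?f i j (n - j - i))"
        by (rule fps_mult_assoc_lemma[where f = "\<lambda>i j k. ?f j i k"])
      finally show "fps_nth (ext_lin phi (fps_scale scale c x)) n = fps_nth (fps_scale scale c (ext_lin phi x)) n"
        by (simp add: ext_lin_def fps_scale_def p.sum p.scale V.scale_sum_right)
    qed
  qed
qed

end

theory Submission imports Defs begin

text \<open>Comparing the coefficients of \<open>t\<close> in the deformation equations gives \<open>d 1 \<in> Z2\<close>; comparing them
  in \<open>\<phi>\<^sub>t (d\<^sub>t(x, y)) = d'\<^sub>t (\<phi>\<^sub>t x, \<phi>\<^sub>t y)\<close> gives \<open>d 1 - d' 1 = \<delta>\<^sup>1 (\<phi> 1)\<close>.\<close>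

text \<open>Constant series have coefficient 0 in degree 1, so these facts remove every term in
  which such a coefficient is an argument.\<close>

lemma bilinear_map_zero:
  assumes "bilinear_map scale f"
  shows "f x 0 = 0" and "f 0 y = 0"
proof -
  interpret l: Vector_Spaces.linear scale scale "\<lambda>y. f x y"
    using assms by (simp add: bilinear_map_def)
  interpret r: Vector_Spaces.linear scale scale "\<lambda>x. f x y"
    using assms by (simp add: bilinear_map_def)
  show "f x 0 = 0" "f 0 y = 0"
    by (fact l.zero, fact r.zero)
qed

lemma ext_bilin_nth_0: "fps_nth (ext_bilin d X Y) 0 = d 0 (fps_nth X 0) (fps_nth Y 0)"
  by (simp add: ext_bilin_def)

text \<open>The degree 1 can come from \<open>Y\<close>, from \<open>X\<close> or from the family
  \<open>d\<close> itself, one term each.\<close>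

lemma ext_bilin_nth_1:
  "fps_nth (ext_bilin d X Y) 1 =
     d 0 (fps_nth X 0) (fps_nth Y 1) + d 0 (fps_nth X 1) (fps_nth Y 0) + d 1 (fps_nth X 0) (fps_nth Y 0)"
  by (simp add: ext_bilin_def)

lemma ext_lin_nth_0: "fps_nth (ext_lin phi X) 0 = phi 0 (fps_nth X 0)"
  by (simp add: ext_lin_def)

lemma ext_lin_nth_1: "fps_nth (ext_lin phi X) 1 = phi 0 (fps_nth X 1) + phi 1 (fps_nth X 0)"
  by (simp add: ext_lin_def)

lemmas ext_nth_01 = ext_bilin_nth_0 ext_bilin_nth_1 ext_lin_nth_0 ext_lin_nth_1

lemma formal_deformation_1_in_Z2:
  assumes "formal_deformation scale mu alpha beta d"
  shows "d 1 \<in> Z2 scale mu alpha beta"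
proof -
  let ?D = "ext_bilin d" and ?C = fps_const
  have bil: "bilinear_map scale (d i)" for i
    using assms by (simp add: formal_deformation_def)
  have d0: "d 0 = mu"
    using assms by (simp add: formal_deformation_def)
  have mult_alpha: "?D (?C (alpha x)) (?C (alpha y)) = ext_map alpha (?D (?C x) (?C y))"
    and mult_beta: "?D (?C (beta x)) (?C (beta y)) = ext_map beta (?D (?C x) (?C y))"
    and alternative: "?D (?D (?C (beta x)) (?C (alpha y))) (?C (beta z))
        - ?D (?C (alpha (beta x))) (?D (?C (alpha y)) (?C z))
        + ?D (?D (?C (beta y)) (?C (alpha x))) (?C (beta z))
        - ?D (?C (alpha (beta y))) (?D (?C (alpha x)) (?C z)) = 0" for x y z
    using assms unfolding formal_deformation_def Let_def by blast+
  \<comment> \<open>The second copy is phrased for \<open>mu\<close>, the form that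
    \<open>d 0\<close> takes once \<open>d0\<close> is used as a rewrite rule.\<close>
  note zero = bilinear_map_zero[OF bil] bilinear_map_zero[OF bil[of 0], unfolded d0]
  have "alpha (d 1 x y) = d 1 (alpha x) (alpha y)" for x y
    using arg_cong[OF mult_alpha[of x y], of "\<lambda>F. fps_nth F 1"]
    \<comment> \<open>Here \<open>[simplified]\<close> turns the index \<open>1\<close> into
      \<open>Suc 0\<close>, the form in which the simplifier meets it.\<close>
    by (simp add: ext_nth_01[simplified] zero ext_map_def)
  moreover have "beta (d 1 x y) = d 1 (beta x) (beta y)" for x y
    using arg_cong[OF mult_beta[of x y], of "\<lambda>F. fps_nth F 1"]
    by (simp add: ext_nth_01[simplified] zero ext_map_def)
  \<comment> \<open>In each nested product the coefficient of t places \<open>d 1\<close> either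
    inside or outside, with \<open>mu\<close> in the other position; the four products thus yield
    the eight terms of \<open>delta2\<close>.\<close>
  moreover have "delta2 mu alpha beta (d 1) x y z = 0" for x y z
    using arg_cong[OF alternative[of x y z], of "\<lambda>F. fps_nth F 1"]
    by (simp add: ext_nth_01[simplified] zero d0 delta2_def algebra_simps)
  ultimately show ?thesis
    using bil by (simp add: Z2_def C2_def)
qed

text \<open>This serves for reflexivity: a cocycle is cohomologous to itself. The zero coboundary
  comes from the zero cochain.\<close>

lemma zero_in_B2:
  assumes "left_bihom_alternative_algebra scale mu alpha beta"
  shows "(\<lambda>x y. 0) \<in> B2 scale mu alpha beta"
proof -
  interpret left_bihom_alternative_algebra scale mu alpha beta by fact
  interpret a: Vector_Spaces.linear scale scale alpha by (fact linear_alpha)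
  interpret b: Vector_Spaces.linear scale scale beta by (fact linear_beta)
  have "Vector_Spaces.linear scale scale (\<lambda>x. 0)"
    by unfold_locales simp_all
  then have "(\<lambda>x. 0) \<in> C1 scale alpha beta"
    by (simp add: C1_def)
  moreover have "delta1 mu (\<lambda>x. 0) = (\<lambda>x y. 0)"
    by (simp add: delta1_def fun_eq_iff bilinear_map_zero[OF bilinear_mu])
  ultimately show ?thesis
    unfolding B2_def by (metis image_eqI)
qed

lemma equivalent_deformations_diff_in_B2:
  assumes alg: "left_bihom_alternative_algebra scale mu alpha beta"
    and d: "formal_deformation scale mu alpha beta d"
    and d': "formal_deformation scale mu alpha beta d'"
    and "equivalent_deformations scale alpha beta d d'"
  shows "(\<lambda>x y. d 1 x y - d' 1 x y) \<in> B2 scale mu alpha beta"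
proof -
  interpret left_bihom_alternative_algebra scale mu alpha beta by fact
  interpret a: Vector_Spaces.linear scale scale alpha by (fact linear_alpha)
  interpret b: Vector_Spaces.linear scale scale beta by (fact linear_beta)
  from assms(4) obtain phi where lin: "\<And>i. Vector_Spaces.linear scale scale (phi i)"
    and phi0: "phi 0 = id"
    and comm_alpha: "ext_lin phi \<circ> ext_map alpha = ext_map alpha \<circ> ext_lin phi"
    and comm_beta: "ext_lin phi \<circ> ext_map beta = ext_map beta \<circ> ext_lin phi"
    and mult: "\<And>x y. ext_lin phi (ext_bilin d (fps_const x) (fps_const y)) =
              ext_bilin d' (ext_lin phi (fps_const x)) (ext_lin phi (fps_const y))"
    unfolding equivalent_deformations_def by blast
  have bil: "bilinear_map scale (d i)" "bilinear_map scale (d' i)" for i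
    using d d' by (simp_all add: formal_deformation_def)
  have d0: "d 0 = mu" "d' 0 = mu"
    using d d' by (simp_all add: formal_deformation_def)
  note zero = bilinear_map_zero[OF bil(1)] bilinear_map_zero[OF bil(2)]
    bilinear_map_zero[OF bil(1)[of 0], unfolded d0]
  \<comment> \<open>On constant series the t-coefficients of the two commutation rules say that
    \<open>phi 1\<close> commutes with \<open>alpha\<close> and \<open>beta\<close>, which makes it
    a 1-cochain.\<close>
  have "alpha (phi 1 x) = phi 1 (alpha x)" for x
    using arg_cong[OF fun_cong[OF comm_alpha, of "fps_const x"], of "\<lambda>F. fps_nth F 1"]
    by (simp add: ext_nth_01[simplified] phi0 ext_map_def)
  moreover have "beta (phi 1 x) = phi 1 (beta x)" for x
    using arg_cong[OF fun_cong[OF comm_beta, of "fps_const x"], of "\<lambda>F. fps_nth F 1"]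
    by (simp add: ext_nth_01[simplified] phi0 ext_map_def)
  ultimately have "phi 1 \<in> C1 scale alpha beta"
    using lin by (simp add: C1_def)
  \<comment> \<open>With \<open>phi 0 = id\<close> the t-coefficient reads \<open>d 1 x y + phi 1
    (mu x y) = mu x (phi 1 y) + mu (phi 1 x) y + d' 1 x y\<close>; rearranging leaves
    \<open>delta1\<close>.\<close>
  moreover have "d 1 x y - d' 1 x y = delta1 mu (phi 1) x y" for x y
    using arg_cong[OF mult[of x y], of "\<lambda>F. fps_nth F 1"]
    by (simp add: ext_nth_01[simplified] zero d0 phi0 delta1_def algebra_simps)
  ultimately show ?thesis
    unfolding B2_def by (intro image_eqI) (auto simp: fun_eq_iff)
qed

theorem theorem3p3:
  fixes scale :: "'k::field_char_0 \<Rightarrow> 'a::ab_group_add \<Rightarrow> 'a"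
    and mu :: "'a \<Rightarrow> 'a \<Rightarrow> 'a" and alpha beta :: "'a \<Rightarrow> 'a"
    and d d' :: "nat \<Rightarrow> 'a \<Rightarrow> 'a \<Rightarrow> 'a"
  assumes "left_bihom_alternative_algebra scale mu alpha beta"
    and "formal_deformation scale mu alpha beta d"
    and "formal_deformation scale mu alpha beta d'"
    and "equivalent_deformations scale alpha beta d d'"
  shows "\<exists>c \<in> H2 scale mu alpha beta. d 1 \<in> c \<and> d' 1 \<in> c"
proof -
  let ?Z = "Z2 scale mu alpha beta" and ?B = "B2 scale mu alpha beta"
  \<comment> \<open>This repeats the relation in \<open>H2_def\<close> so that
    \<open>quotientI\<close> applies; the common class will be that of \<open>d 1\<close>.\<close>
  let ?r = "{(f, g). f \<in> ?Z \<and> g \<in> ?Z \<and> (\<lambda>x y. f x y - g x y) \<in> ?B}"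
  have Z: "d 1 \<in> ?Z" "d' 1 \<in> ?Z"
    using formal_deformation_1_in_Z2 assms(2,3) by blast+
  then have "?r `` {d 1} \<in> H2 scale mu alpha beta"
    unfolding H2_def by (intro quotientI)
  moreover have "d 1 \<in> ?r `` {d 1}"
    using Z zero_in_B2[OF assms(1)] by simp
  \<comment> \<open>The class consists of the cocycles \<open>g\<close> with \<open>d 1 - g\<close>
    a coboundary, so the difference has the right sign.\<close>
  moreover have "d' 1 \<in> ?r `` {d 1}"
    using Z equivalent_deformations_diff_in_B2[OF assms] by simp
  ultimately show ?thesis by (intro bexI conjI)
qed

end
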